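(* Let $\alpha\in(0,1)$. (i) For every $t\ge0$ the semigroup $P_t$ maps $\mathcal C^{\alpha+1}$ into itself. Moreover, if $h\in\mathcal C^{1+\alpha+\nu}$ for some $\nu>0$ such that $\alpha+\nu\in(0,1)$, then $P_\cdot h\in C_T\mathcal C^{1+\alpha}$. (ii) For every $t\ge0$ the semigroup $P_t$ maps $D\mathcal C^\alpha$ into itself. Moreover, if $h\in D\mathcal C^{\alpha+\nu}$ for some $\nu>0$ such that $\alpha+\nu\in(0,1)$, then $P_\cdot h\in C_TD\mathcal C^\alpha$.
   Context: Fix $d\ge1$, $T>0$. For $\gamma\in\mathbb R$, $\mathcal C^\gamma=\mathcal C^\gamma(\mathbb R^d)$ is the Besov (Hölder–Zygmund) space $B^\gamma_{\infty,\infty}$, with norm $\|\cdot\|_\gamma$; for $\gamma>0$ non-integer it is the classical Hölder space of bounded functions with bounded derivatives up to order $\lfloor\gamma\rfloor$ whose derivatives of order $\lfloor\gamma\rfloor$ are $(\gamma-\lfloor\gamma\rfloor)$-Hölder. For $\alpha\in(0,1)$, $D\mathcal C^\alpha$ is the space of differentiable $h:\mathbb R^d\to\mathbb R$ with $\nabla h\in\mathcal C^\alpha$, with norm $\|h\|_{D\mathcal C^\alpha}=|h(0)|+\|\nabla h\|_\alpha$. $C_TX:=C([0,T];X)$. $P_t$ is the heat semigroup generated by $\tfrac12\Delta$, i.e. convolution with $p_t(x)=(2\pi t)^{-d/2}e^{-|x|^2/(2t)}$ for $t>0$, $P_0=\mathrm{Id}$ (extended to Schwartz distributions by duality). $P_\cdot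 h$ denotes $t\mapsto P_th$. *)

theory Defs
  imports "HOL-Analysis.Analysis"
begin

text \<open>
  The state space \<open>\<real>\<^sup>d\<close>, \<open>d \<ge> 1\<close>, is an arbitrary type \<open>'a::euclidean_space\<close> with
  \<open>d = DIM('a)\<close>.  Only exponents \<open>\<gamma> > 0\<close>, \<open>\<gamma> \<notin> \<int>\<close> occur, for which the Besov space
  \<open>B\<^sup>\<gamma>\<close> with both indices infinite is the classical Hoelder space (with an equivalent norm).
\<close>

subsection \<open>Hoelder spaces\<close>

definition sup_norm :: "('a \<Rightarrow> 'b::real_normed_vector) \<Rightarrow> real" where
  "sup_norm f = (SUP x. norm (f x))"

definition holder_seminorm ::
    "real \<Rightarrow> ('a::euclidean_space \<Rightarrow> 'b::real_normed_vector) \<Rightarrow> real" where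
  "holder_seminorm \<theta> f =
     (SUP (x, y) \<in> {(x, y). x \<noteq> y}. norm (f x - f y) / dist x y powr \<theta>)"

definition partial_deriv ::
    "'a::euclidean_space \<Rightarrow> ('a \<Rightarrow> 'b::real_normed_vector) \<Rightarrow> 'a \<Rightarrow> 'b" where
  "partial_deriv i f = (\<lambda>x. frechet_derivative f (at x) i)"

text \<open>
  Bounded derivatives up to order \<open>k\<close>, with \<open>\<theta>\<close>-Hoelder derivatives of order \<open>k\<close>;
  by recursion on \<open>k\<close>, passing to the first-order partial derivatives.
\<close>

primrec holder_class ::
    "nat \<Rightarrow> real \<Rightarrow> ('a::euclidean_space \<Rightarrow> 'b::real_normed_vector) \<Rightarrow> bool" where
  "holder_class 0 \<theta> f \<longleftrightarrow>
     bounded (range f) \<and> (\<exists>C. \<forall>x y. norm (f x - f y) \<le> C * dist x y powr \<theta>)"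
| "holder_class (Suc k) \<theta> f \<longleftrightarrow>
     bounded (range f) \<and> (\<forall>x. f differentiable (at x)) \<and>
     (\<forall>i\<in>Basis. holder_class k \<theta> (partial_deriv i f))"

primrec holder_class_norm ::
    "nat \<Rightarrow> real \<Rightarrow> ('a::euclidean_space \<Rightarrow> 'b::real_normed_vector) \<Rightarrow> real" where
  "holder_class_norm 0 \<theta> f = sup_norm f + holder_seminorm \<theta> f"
| "holder_class_norm (Suc k) \<theta> f =
     sup_norm f + (\<Sum>i\<in>Basis. holder_class_norm k \<theta> (partial_deriv i f))"

text \<open>
  Meaningful only for \<open>\<gamma> > 0\<close>, \<open>\<gamma> \<notin> \<int>\<close>.  The norm uses suprema in the conditionally
  complete order \<open>real\<close>, so it is meaningful only on members of \<open>holder_space \<gamma>\<close>.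
\<close>

definition holder_space ::
    "real \<Rightarrow> ('a::euclidean_space \<Rightarrow> 'b::real_normed_vector) set" where
  "holder_space \<gamma> = {f. holder_class (nat \<lfloor>\<gamma>\<rfloor>) (frac \<gamma>) f}"

definition holder_norm ::
    "real \<Rightarrow> ('a::euclidean_space \<Rightarrow> 'b::real_normed_vector) \<Rightarrow> real" where
  "holder_norm \<gamma> f = holder_class_norm (nat \<lfloor>\<gamma>\<rfloor>) (frac \<gamma>) f"

subsection \<open>Functions with Hoelder gradient\<close>

definition gradient :: "('a::euclidean_space \<Rightarrow> real) \<Rightarrow> 'a \<Rightarrow> 'a" where
  "gradient h x = (\<Sum>i\<in>Basis. partial_deriv i h x *\<^sub>R i)"

definition D_holder_space :: "real \<Rightarrow> ('a::euclidean_space \<Rightarrow> real) set" where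
  "D_holder_space \<alpha> = {h. (\<forall>x. h differentiable (at x)) \<and> gradient h \<in> holder_space \<alpha>}"

definition D_holder_norm :: "real \<Rightarrow> ('a::euclidean_space \<Rightarrow> real) \<Rightarrow> real" where
  "D_holder_norm \<alpha> h = \<bar>h 0\<bar> + holder_norm \<alpha> (gradient h)"

subsection \<open>Continuous paths in a normed function space\<close>

text \<open>
  The space \<open>C([0,T]; X)\<close> for a linear space \<open>X\<close> of functions with norm \<open>N\<close>.
\<close>

definition C_T ::
    "real \<Rightarrow> ('a \<Rightarrow> real) set \<Rightarrow> (('a \<Rightarrow> real) \<Rightarrow> real) \<Rightarrow> (real \<Rightarrow> 'a \<Rightarrow> real) set" where
  "C_T T X N = {u. (\<forall>t\<in>{0..T}. u t \<in> X) \<and>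
     (\<forall>t\<in>{0..T}. ((\<lambda>s. N (\<lambda>x. u s x - u t x)) \<longlongrightarrow> 0) (at t within {0..T}))}"

subsection \<open>The heat semigroup\<close>

definition heat_kernel :: "real \<Rightarrow> 'a::euclidean_space \<Rightarrow> real" where
  "heat_kernel t x =
     (2 * pi * t) powr (- (real DIM('a) / 2)) * exp (- ((norm x)\<^sup>2 / (2 * t)))"

text \<open>
  Functions in the spaces above are continuous with at most linear growth, so for \<open>t > 0\<close>
  the convolution integral converges absolutely and agrees with the extension of the
  semigroup to distributions by duality.
\<close>

definition heat_semigroup ::
    "real \<Rightarrow> ('a::euclidean_space \<Rightarrow> real) \<Rightarrow> 'a \<Rightarrow> real" where
  "heat_semigroup t h =
     (if t > 0 then (\<lambda>x. LINT y|lborel. heat_kernel t (x - y) * h y) else h)"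

end

theory Submission
  imports Defs "HOL-Probability.Distributions"
begin

text \<open>
  After the substitution \<open>y = x + \<surd>t w\<close> the semigroup reads \<open>P\<^sub>t h(x) = \<integral> g(w) h(x + \<surd>t w) dw\<close> with
  the standard Gaussian density \<open>g\<close>, also for \<open>t = 0\<close>.  An average of translates inherits every
  bound and every Hoelder constant of \<open>h\<close>.  It also commutes with the gradient, because a Hoelder
  gradient makes the first-order Taylor remainder of \<open>h\<close> uniform in the base point
  (\<open>gaussian_average_has_derivative\<close>).  Hence \<open>\<nabla> P\<^sub>t h\<close> is the average of \<open>\<nabla> h\<close> and is as regular as
  \<open>\<nabla> h\<close>, which gives the invariance of both scales of spaces.

  For continuity in time put \<open>\<eta> = \<bar>\<surd>s - \<surd>t\<bar>\<close>.  Passing from time \<open>t\<close> to time \<open>s\<close> shifts the argument by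
  at most \<open>\<eta> \<bar>w\<bar>\<close>, so a function that is Hoelder of exponent \<open>\<alpha> + \<nu>\<close> changes by at most a constant
  times \<open>\<eta>\<close> to the power \<open>\<alpha> + \<nu>\<close> (\<open>gaussian_average_scale_diff\<close>).  Interpolating this with the
  regularity in space bounds the \<open>\<alpha>\<close>-Hoelder seminorm of the change by a constant times \<open>\<eta>\<close> to the
  power \<open>\<nu>\<close> (\<open>gaussian_average_scale_diff_holder\<close>); the loss of \<open>\<nu>\<close> is what pays for convergence.
  Applied to \<open>\<nabla> h\<close>, and with exponent 1 to the Lipschitz function \<open>h\<close> itself, these estimates give
  convergence in the norms of both scales.  The two scales differ only by boundedness of the
  function (\<open>holder_space_Suc_eq\<close>), so they are treated together.
\<close>


section \<open>Hoelder continuity with explicit constants\<close>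

text \<open>
  The exponent \<open>\<theta> = 1\<close> is included: it is the Lipschitz condition, which functions with
  bounded gradient satisfy.
\<close>

definition holder_continuous ::
    "real \<Rightarrow> real \<Rightarrow> ('a::euclidean_space \<Rightarrow> 'b::real_normed_vector) \<Rightarrow> bool" where
  "holder_continuous \<theta> C f \<longleftrightarrow> 0 \<le> C \<and> (\<forall>x y. norm (f x - f y) \<le> C * dist x y powr \<theta>)"

lemma holder_continuousD:
  assumes "holder_continuous \<theta> C f"
  shows "0 \<le> C" "norm (f x - f y) \<le> C * dist x y powr \<theta>"
  using assms by (auto simp: holder_continuous_def)

lemma holder_class_0_iff:
  "holder_class 0 \<theta> f \<longleftrightarrow> (\<exists>A C. (\<forall>x. norm (f x) \<le> A) \<and> holder_continuous \<theta> C f)"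
proof
  assume "holder_class 0 \<theta> f"
  then obtain A C where A: "\<forall>x. norm (f x) \<le> A"
    and C: "\<forall>x y. norm (f x - f y) \<le> C * dist x y powr \<theta>"
    by (auto simp: bounded_iff)
  have "C * dist x y powr \<theta> \<le> max 0 C * dist x y powr \<theta>" for x y :: 'a
    by (intro mult_right_mono) auto
  with C have "holder_continuous \<theta> (max 0 C) f"
    unfolding holder_continuous_def by (meson max.cobounded1 order_trans)
  with A show "\<exists>A C. (\<forall>x. norm (f x) \<le> A) \<and> holder_continuous \<theta> C f" by blast
next
  assume "\<exists>A C. (\<forall>x. norm (f x) \<le> A) \<and> holder_continuous \<theta> C f"
  then show "holder_class 0 \<theta> f"
    by (auto simp: bounded_iff holder_continuous_def)
qed

lemma holder_continuous_imp_continuous: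
  assumes "holder_continuous \<theta> C f" "0 < \<theta>"
  shows "continuous_on UNIV f"
proof -
  have "(f \<longlongrightarrow> f x) (at x)" for x
  proof (rule Lim_null_comparison[where g = "\<lambda>y. C * dist y x powr \<theta>", THEN Lim_null[THEN iffD2]])
    show "\<forall>\<^sub>F y in at x. norm (f y - f x) \<le> C * dist y x powr \<theta>"
      using assms by (auto simp: holder_continuous_def)
    have "((\<lambda>y. dist y x powr \<theta>) \<longlongrightarrow> 0) (at x)"
      using assms(2) by (intro tendsto_zero_powrI[where b = \<theta>])
        (auto intro!: tendsto_eq_intros)
    then show "((\<lambda>y. C * dist y x powr \<theta>) \<longlongrightarrow> 0) (at x)"
      by (rule tendsto_mult_right_zero)
  qed
  then show ?thesis
    by (simp add: continuous_on_def)
qed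

lemma powr_le_1_plus:
  fixes u \<theta> :: real
  assumes "0 \<le> u" "0 \<le> \<theta>" "\<theta> \<le> 1"
  shows "u powr \<theta> \<le> 1 + u"
proof (cases "u \<le> 1")
  case True
  then have "u powr \<theta> \<le> 1" using assms by (intro powr_le1) auto
  then show ?thesis using assms by simp
next
  case False
  then have "u powr \<theta> \<le> u powr 1" using assms by (intro powr_mono) auto
  then show ?thesis using assms by simp
qed

lemma holder_continuous_linear_growth:
  assumes "holder_continuous \<theta> C f" "0 < \<theta>" "\<theta> \<le> 1"
  shows "norm (f x) \<le> (norm (f 0) + C) + C * norm x"
proof -
  have "norm (f x) \<le> norm (f 0) + norm (f x - f 0)"
    by (metis norm_triangle_sub)
  also have "norm (f x - f 0) \<le> C * norm x powr \<theta>"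
    using holder_continuousD(2)[OF assms(1), of x 0] by simp
  also have "C * norm x powr \<theta> \<le> C * (1 + norm x)"
    using assms holder_continuousD(1)[OF assms(1)] by (intro mult_left_mono powr_le_1_plus) auto
  finally show ?thesis by (simp add: algebra_simps)
qed

lemma sup_norm_bounds:
  assumes "\<And>x. norm (f x) \<le> A"
  shows "0 \<le> sup_norm f" "sup_norm f \<le> A"
proof -
  have "bdd_above (range (\<lambda>x. norm (f x)))" using assms by (intro bdd_aboveI2)
  then have "norm (f undefined) \<le> sup_norm f" unfolding sup_norm_def by (intro cSUP_upper) auto
  then show "0 \<le> sup_norm f" by (rule order_trans[OF norm_ge_zero])
  show "sup_norm f \<le> A" unfolding sup_norm_def using assms by (intro cSUP_least) auto
qed

text \<open>
  The suprema in the norm are taken in a conditionally complete order, so a lower bound needs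
  an argument too: the seminorm is a supremum of a nonempty, bounded set of nonnegative numbers.
\<close>

lemma holder_class_norm_0_bounds:
  fixes f :: "'a::euclidean_space \<Rightarrow> 'b::real_normed_vector"
  assumes A: "\<And>x. norm (f x) \<le> A" and B: "holder_continuous \<theta> B f"
  shows "0 \<le> holder_class_norm 0 \<theta> f" "holder_class_norm 0 \<theta> f \<le> A + B"
proof -
  let ?S = "{(x, y). x \<noteq> (y::'a)}"
  let ?q = "\<lambda>(x, y). norm (f x - f y) / dist x y powr \<theta>"
  obtain b :: 'a where "b \<in> Basis" using nonempty_Basis by blast
  then have b: "(b, 0) \<in> ?S" by auto
  have q: "?q p \<le> B" if "p \<in> ?S" for p
    using that holder_continuousD(2)[OF B, of "fst p" "snd p"]
    by (auto simp: divide_le_eq split: prod.splits)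
  have bdd: "bdd_above (?q ` ?S)" using q by (intro bdd_aboveI2) auto
  have "0 \<le> ?q (b, 0)" by simp
  also have "\<dots> \<le> holder_seminorm \<theta> f"
    unfolding holder_seminorm_def using b bdd by (rule cSUP_upper)
  finally have "0 \<le> holder_seminorm \<theta> f" .
  moreover have "holder_seminorm \<theta> f \<le> B"
    unfolding holder_seminorm_def using b q by (intro cSUP_least) auto
  moreover have "0 \<le> sup_norm f" "sup_norm f \<le> A" using sup_norm_bounds[of f, OF A] by auto
  ultimately show "0 \<le> holder_class_norm 0 \<theta> f" "holder_class_norm 0 \<theta> f \<le> A + B"
    by simp_all
qed


section \<open>Gradients\<close>

lemma gradient_partial_deriv_eq:
  assumes "\<And>x. (h has_derivative (\<lambda>v. v \<bullet> G x)) (at x)"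
  shows "partial_deriv i h = (\<lambda>x. i \<bullet> G x)" "gradient h = G"
proof -
  show *: "partial_deriv i h = (\<lambda>x. i \<bullet> G x)" for i
    unfolding partial_deriv_def using frechet_derivative_at[OF assms] by metis
  show "gradient h = G"
    unfolding gradient_def * by (subst inner_commute) (simp add: euclidean_representation)
qed

lemma has_derivative_gradient:
  fixes h :: "'a::euclidean_space \<Rightarrow> real"
  assumes "h differentiable (at x)"
  shows "(h has_derivative (\<lambda>v. v \<bullet> gradient h x)) (at x)"
proof -
  let ?D = "frechet_derivative h (at x)"
  have D: "(h has_derivative ?D) (at x)"
    using assms frechet_derivative_works by blast
  then interpret bounded_linear ?D by (rule has_derivative_bounded_linear)
  have "?D v = v \<bullet> gradient h x" for v
  proof -
    have "?D v = ?D (\<Sum>i\<in>Basis. (v \<bullet> i) *\<^sub>R i)" by (simp add: euclidean_representation)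
    also have "\<dots> = (\<Sum>i\<in>Basis. (v \<bullet> i) * ?D i)" by (simp add: sum scale)
    also have "\<dots> = v \<bullet> gradient h x"
      by (simp add: gradient_def partial_deriv_def inner_sum_right mult.commute)
    finally show ?thesis .
  qed
  then have "?D = (\<lambda>v. v \<bullet> gradient h x)" by auto
  with D show ?thesis by simp
qed

lemma mean_value_gradient:
  fixes h :: "'a::euclidean_space \<Rightarrow> real"
  assumes "\<And>x. (h has_derivative (\<lambda>v. v \<bullet> G x)) (at x)"
  obtains s where "0 \<le> s" "s \<le> 1" "h (x + v) - h x = v \<bullet> G (x + s *\<^sub>R v)"
proof -
  let ?\<phi> = "\<lambda>s. h (x + s *\<^sub>R v)"
  have "(?\<phi> has_derivative (\<lambda>e. (e *\<^sub>R v) \<bullet> G (x + s *\<^sub>R v))) (at s)" for s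
    by (rule has_derivative_compose[OF _ assms]) (auto intro!: derivative_eq_intros)
  then have "(?\<phi> has_real_derivative v \<bullet> G (x + s *\<^sub>R v)) (at s)" for s
    by (simp add: has_field_derivative_def mult.commute[of "v \<bullet> _"] mult_commute_abs)
  then have "\<exists>s>0. s < 1 \<and> ?\<phi> 1 - ?\<phi> 0 = (1 - 0) * (v \<bullet> G (x + s *\<^sub>R v))"
    by (intro MVT2) auto
  then obtain s where "0 < s" "s < 1" "h (x + v) - h x = v \<bullet> G (x + s *\<^sub>R v)" by auto
  then show ?thesis by (intro that[of s]) auto
qed

lemma bounded_gradient_imp_lipschitz:
  fixes h :: "'a::euclidean_space \<Rightarrow> real"
  assumes "\<And>x. (h has_derivative (\<lambda>v. v \<bullet> G x)) (at x)" "\<And>x. norm (G x) \<le> A"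
  shows "holder_continuous 1 A h"
  unfolding holder_continuous_def
proof (intro conjI allI)
  show "0 \<le> A" using assms(2)[of 0] norm_ge_zero order_trans by blast
  show "norm (h x - h y) \<le> A * dist x y powr 1" for x y
  proof -
    obtain s where "h (y + (x - y)) - h y = (x - y) \<bullet> G (y + s *\<^sub>R (x - y))"
      using mean_value_gradient[OF assms(1)] by metis
    then have "norm (h x - h y) \<le> norm (x - y) * norm (G (y + s *\<^sub>R (x - y)))"
      by (simp add: Cauchy_Schwarz_ineq2)
    also have "\<dots> \<le> norm (x - y) * A" using assms(2) by (intro mult_left_mono) auto
    finally show ?thesis by (simp add: dist_norm mult.commute)
  qed
qed

text \<open>
  A Hoelder gradient gives a remainder of order \<open>1 + \<theta>\<close>, uniformly in the base point.  Such a
  uniform expansion can be integrated against a probability density, which is how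
  differentiation will be seen to commute with Gaussian averages.
\<close>

lemma taylor_remainder_holder_gradient:
  fixes h :: "'a::euclidean_space \<Rightarrow> real"
  assumes "\<And>x. (h has_derivative (\<lambda>v. v \<bullet> G x)) (at x)"
    and G: "holder_continuous \<theta> C G" and "0 < \<theta>"
  shows "norm (h (x + v) - h x - v \<bullet> G x) \<le> C * norm v powr \<theta> * norm v"
proof -
  obtain s where s: "0 \<le> s" "s \<le> 1" "h (x + v) - h x = v \<bullet> G (x + s *\<^sub>R v)"
    using mean_value_gradient[OF assms(1)] by metis
  have "norm (h (x + v) - h x - v \<bullet> G x) = \<bar>v \<bullet> (G (x + s *\<^sub>R v) - G x)\<bar>"
    by (simp add: s(3) inner_diff_right)
  also have "\<dots> \<le> norm v * norm (G (x + s *\<^sub>R v) - G x)"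
    by (rule Cauchy_Schwarz_ineq2)
  also have "\<dots> \<le> norm v * (C * norm v powr \<theta>)"
  proof (rule mult_left_mono)
    have "norm (G (x + s *\<^sub>R v) - G x) \<le> C * (s * norm v) powr \<theta>"
      using holder_continuousD(2)[OF G, of "x + s *\<^sub>R v" x] s by (simp add: dist_norm)
    also have "\<dots> \<le> C * norm v powr \<theta>"
      using s \<open>0 < \<theta>\<close> holder_continuousD(1)[OF G]
      by (intro mult_left_mono powr_mono2) (auto simp: mult_left_le_one_le)
    finally show "norm (G (x + s *\<^sub>R v) - G x) \<le> C * norm v powr \<theta>" .
  qed simp
  finally show ?thesis by (simp add: mult_ac)
qed


section \<open>The spaces of the theorem in terms of Hoelder constants\<close>

lemma floor_frac_unit_interval:
  fixes \<theta> :: real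
  assumes "0 < \<theta>" "\<theta> < 1"
  shows "nat \<lfloor>\<theta>\<rfloor> = 0" "frac \<theta> = \<theta>" "nat \<lfloor>1 + \<theta>\<rfloor> = Suc 0" "frac (1 + \<theta>) = \<theta>"
proof -
  show "frac \<theta> = \<theta>" using assms by (simp add: frac_eq)
  have "\<lfloor>\<theta>\<rfloor> = 0" using assms by (simp add: floor_eq_iff)
  then show "nat \<lfloor>\<theta>\<rfloor> = 0" by simp
  have "\<lfloor>1 + \<theta>\<rfloor> = 1" using assms by (simp add: floor_eq_iff)
  then show "nat \<lfloor>1 + \<theta>\<rfloor> = Suc 0" "frac (1 + \<theta>) = \<theta>" by (simp_all add: frac_def)
qed

lemma D_holder_space_iff:
  fixes h :: "'a::euclidean_space \<Rightarrow> real"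
  assumes "0 < \<theta>" "\<theta> < 1"
  shows "h \<in> D_holder_space \<theta> \<longleftrightarrow>
    (\<exists>G A C. (\<forall>x. (h has_derivative (\<lambda>v. v \<bullet> G x)) (at x)) \<and> (\<forall>x. norm (G x) \<le> A) \<and>
      holder_continuous \<theta> C G)" (is "_ \<longleftrightarrow> ?R")
proof
  assume "h \<in> D_holder_space \<theta>"
  then show ?R
    unfolding D_holder_space_def holder_space_def floor_frac_unit_interval[OF assms]
      mem_Collect_eq holder_class_0_iff
    using has_derivative_gradient by blast
next
  assume ?R
  then obtain G A C where h: "\<And>x. (h has_derivative (\<lambda>v. v \<bullet> G x)) (at x)"
    and G: "\<forall>x. norm (G x) \<le> A" "holder_continuous \<theta> C G" by blast
  show "h \<in> D_holder_space \<theta>"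
    unfolding D_holder_space_def holder_space_def floor_frac_unit_interval[OF assms]
      mem_Collect_eq holder_class_0_iff gradient_partial_deriv_eq(2)[OF h]
    using G h differentiableI by blast
qed

text \<open>
  Less regularity suffices for membership: distances at most 1 are covered by monotonicity of the
  power, distances above 1 by boundedness.
\<close>

lemma D_holder_space_mono:
  fixes h :: "'a::euclidean_space \<Rightarrow> real"
  assumes "0 < \<alpha>" "\<alpha> \<le> \<beta>" "\<beta> < 1" "h \<in> D_holder_space \<beta>"
  shows "h \<in> D_holder_space \<alpha>"
proof -
  have \<alpha>: "\<alpha> < 1" and \<beta>: "0 < \<beta>" using assms by auto
  obtain G A C where h: "\<And>x. (h has_derivative (\<lambda>v. v \<bullet> G x)) (at x)"
    and A: "\<And>x. norm (G x) \<le> A" and G: "holder_continuous \<beta> C G"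
    using assms(4) unfolding D_holder_space_iff[OF \<beta> assms(3)] by blast
  have A0: "0 \<le> A" using A[of 0] norm_ge_zero order_trans by blast
  have C0: "0 \<le> C" using holder_continuousD(1)[OF G] .
  have "norm (G x - G y) \<le> (2 * A + C) * dist x y powr \<alpha>" for x y
  proof (cases "dist x y \<le> 1")
    case True
    have "norm (G x - G y) \<le> C * dist x y powr \<beta>" by (rule holder_continuousD(2)[OF G])
    also have "\<dots> \<le> (2 * A + C) * dist x y powr \<alpha>"
      using assms True A0 C0 by (intro mult_mono powr_mono') auto
    finally show ?thesis .
  next
    case False
    have "norm (G x - G y) \<le> 2 * A"
      using norm_triangle_ineq4[of "G x" "G y"] A[of x] A[of y] by simp
    also have "\<dots> \<le> (2 * A + C) * 1" using C0 by simp
    also have "\<dots> \<le> (2 * A + C) * dist x y powr \<alpha>"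
      using False assms A0 C0 by (intro mult_left_mono ge_one_powr_ge_zero) auto
    finally show ?thesis .
  qed
  then have "holder_continuous \<alpha> (2 * A + C) G"
    using A0 C0 by (simp add: holder_continuous_def)
  then show ?thesis
    unfolding D_holder_space_iff[OF assms(1) \<alpha>] using h A by blast
qed

lemma holder_continuous_inner:
  assumes "holder_continuous \<theta> C G" "norm i \<le> 1"
  shows "holder_continuous \<theta> C (\<lambda>x. i \<bullet> G x)"
proof -
  have "\<bar>i \<bullet> G x - i \<bullet> G y\<bar> \<le> norm (G x - G y)" for x y
  proof -
    have "\<bar>i \<bullet> G x - i \<bullet> G y\<bar> \<le> norm i * norm (G x - G y)"
      unfolding inner_diff_right[symmetric] by (rule Cauchy_Schwarz_ineq2)
    also have "\<dots> \<le> norm (G x - G y)" using assms(2) by (simp add: mult_left_le_one_le)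
    finally show ?thesis .
  qed
  with assms(1) show ?thesis
    unfolding holder_continuous_def real_norm_def by (meson order_trans)
qed

lemma abs_inner_le:
  fixes v :: "'a::euclidean_space"
  assumes "norm v \<le> A" "i \<in> Basis"
  shows "\<bar>i \<bullet> v\<bar> \<le> A"
  using Basis_le_norm[OF assms(2), of v] assms(1) by (simp add: inner_commute)

text \<open>
  The gradient and the family of partial derivatives control each other, so the two scales of
  spaces need only one argument.
\<close>

lemma holder_space_Suc_eq:
  assumes "0 < \<theta>" "\<theta> < 1"
  shows "holder_space (1 + \<theta>) =
    {h :: 'a::euclidean_space \<Rightarrow> real. bounded (range h)} \<inter> D_holder_space \<theta>"
proof (intro set_eqI iffI)
  fix h :: "'a \<Rightarrow> real"
  assume "h \<in> holder_space (1 + \<theta>)"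
  then have h: "bounded (range h)" "\<And>x. h differentiable (at x)"
    "\<forall>i\<in>Basis. \<exists>A C. (\<forall>x. norm (partial_deriv i h x) \<le> A) \<and>
       holder_continuous \<theta> C (partial_deriv i h)"
    unfolding holder_space_def floor_frac_unit_interval[OF assms] mem_Collect_eq
      holder_class.simps(2) holder_class_0_iff[symmetric] by blast+
  then obtain A C where AC: "\<And>i x. i \<in> Basis \<Longrightarrow> norm (partial_deriv i h x) \<le> A i"
    "\<And>i. i \<in> Basis \<Longrightarrow> holder_continuous \<theta> (C i) (partial_deriv i h)"
    by metis
  have "norm (gradient h x) \<le> (\<Sum>i\<in>Basis. A i)" for x
    unfolding gradient_def by (rule sum_norm_le) (use AC in auto)
  moreover have "holder_continuous \<theta> (\<Sum>i\<in>Basis. C i) (gradient h)"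
    unfolding holder_continuous_def
  proof (intro conjI allI)
    show "0 \<le> (\<Sum>i\<in>Basis. C i)"
      using AC(2) by (auto intro!: sum_nonneg simp: holder_continuous_def)
    fix x y
    have "gradient h x - gradient h y =
        (\<Sum>i\<in>Basis. (partial_deriv i h x - partial_deriv i h y) *\<^sub>R i)"
      by (simp add: gradient_def sum_subtractf scaleR_diff_left)
    also have "norm \<dots> \<le> (\<Sum>i\<in>Basis. C i * dist x y powr \<theta>)"
      by (rule sum_norm_le) (use AC in \<open>auto simp: holder_continuous_def\<close>)
    finally show "norm (gradient h x - gradient h y) \<le> (\<Sum>i\<in>Basis. C i) * dist x y powr \<theta>"
      by (simp add: sum_distrib_right)
  qed
  ultimately have "h \<in> D_holder_space \<theta>"
    unfolding D_holder_space_iff[OF assms] using has_derivative_gradient[OF h(2)] by blast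
  with h(1) show "h \<in> {h. bounded (range h)} \<inter> D_holder_space \<theta>" by simp
next
  fix h :: "'a \<Rightarrow> real"
  assume "h \<in> {h. bounded (range h)} \<inter> D_holder_space \<theta>"
  then have b: "bounded (range h)" and "h \<in> D_holder_space \<theta>" by auto
  then obtain G A C where h: "\<And>x. (h has_derivative (\<lambda>v. v \<bullet> G x)) (at x)"
    and G: "\<And>x. norm (G x) \<le> A" "holder_continuous \<theta> C G"
    unfolding D_holder_space_iff[OF assms] by blast
  have "holder_class 0 \<theta> (partial_deriv i h)" if "i \<in> Basis" for i
    unfolding gradient_partial_deriv_eq(1)[OF h] holder_class_0_iff
    using abs_inner_le[OF G(1) that] holder_continuous_inner[OF G(2), of i] that by auto
  moreover have "h differentiable (at x)" for x
    using h differentiableI by blast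
  ultimately show "h \<in> holder_space (1 + \<theta>)"
    unfolding holder_space_def floor_frac_unit_interval[OF assms] mem_Collect_eq
      holder_class.simps(2) using b by blast
qed


section \<open>The standard Gaussian density\<close>

lemma norm_power2_eq_sum: "(norm x)\<^sup>2 = (\<Sum>b\<in>Basis. (x \<bullet> b)\<^sup>2)"
  for x :: "'a::euclidean_space"
  unfolding power2_norm_eq_inner by (subst euclidean_inner) (simp add: power2_eq_square)

lemma heat_kernel_eq_prod:
  fixes x :: "'a::euclidean_space"
  assumes "0 < t"
  shows "heat_kernel t x = (\<Prod>b\<in>Basis. normal_density 0 (sqrt t) (x \<bullet> b))"
proof -
  have "(2 * pi * t) powr (- (real DIM('a) / 2)) = (1 / sqrt (2 * pi * t)) ^ DIM('a)"
  proof -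
    have "(2 * pi * t) powr (- (real DIM('a) / 2)) = ((2 * pi * t) powr (- (1/2))) powr real DIM('a)"
      by (simp add: powr_powr)
    also have "(2 * pi * t) powr (- (1/2)) = 1 / sqrt (2 * pi * t)"
      using assms powr_half_sqrt[of "2 * pi * t"] powr_minus_divide[of "2 * pi * t" "1/2"] by simp
    finally show ?thesis using assms by (simp add: powr_realpow)
  qed
  moreover have "exp (- ((norm x)\<^sup>2 / (2 * t))) = (\<Prod>b\<in>Basis. exp (- (x \<bullet> b)\<^sup>2 / (2 * t)))"
    by (subst exp_sum[symmetric])
      (simp_all add: norm_power2_eq_sum sum_divide_distrib[symmetric] sum_negf)
  ultimately show ?thesis
    using assms by (simp add: heat_kernel_def normal_density_def prod.distrib prod_dividef
        power_divide)
qed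

lemma heat_kernel_nonneg: "0 \<le> heat_kernel t x"
  by (simp add: heat_kernel_def)

lemma heat_kernel_measurable [measurable]: "heat_kernel t \<in> borel_measurable borel"
  unfolding heat_kernel_def[abs_def] by measurable

lemma heat_kernel_integral:
  assumes "0 < t"
  shows "integrable lborel (heat_kernel t :: 'a::euclidean_space \<Rightarrow> real)"
    and "(LINT x|lborel. heat_kernel t (x :: 'a)) = 1"
proof -
  let ?n = "normal_density 0 (sqrt t)"
  interpret product_sigma_finite "\<lambda>b::'a. lborel :: real measure" by standard
  have \<sigma>: "0 < sqrt t" using assms by simp
  have prod_eq: "heat_kernel t (\<Sum>b\<in>Basis. f b *\<^sub>R b :: 'a) = (\<Prod>b\<in>Basis. ?n (f b))" for f
    using assms by (auto simp: heat_kernel_eq_prod intro!: prod.cong)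
  have T: "(\<lambda>f. \<Sum>b\<in>Basis. f b *\<^sub>R b :: 'a) \<in> (\<Pi>\<^sub>M b\<in>Basis. lborel) \<rightarrow>\<^sub>M borel"
    by measurable
  have i: "integrable (\<Pi>\<^sub>M b\<in>(Basis::'a set). lborel) (\<lambda>f. \<Prod>b\<in>Basis. ?n (f b))"
    using \<sigma> by (intro product_integrable_prod) auto
  show "integrable lborel (heat_kernel t :: 'a \<Rightarrow> real)"
    by (subst lborel_eq, subst integrable_distr_eq[OF T]) (use i in \<open>auto simp: prod_eq\<close>)
  have "(LINT x|lborel. heat_kernel t (x :: 'a)) =
      (LINT f|(\<Pi>\<^sub>M b\<in>(Basis::'a set). lborel). (\<Prod>b\<in>Basis. ?n (f b)))"
    by (subst lborel_eq, subst integral_distr[OF T]) (auto simp: prod_eq)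
  also have "\<dots> = (\<Prod>b\<in>(Basis::'a set). LINT x|lborel. ?n x)"
    using \<sigma> by (intro product_integral_prod) auto
  also have "\<dots> = 1" using \<sigma> by simp
  finally show "(LINT x|lborel. heat_kernel t (x :: 'a)) = 1" .
qed

text \<open>
  The first moment is controlled by the Gaussian of twice the variance, because
  \<open>u exp (- u\<^sup>2 / 4) \<le> 1\<close>.
\<close>

lemma heat_kernel_first_moment_integrable:
  "integrable lborel (\<lambda>w :: 'a::euclidean_space. heat_kernel 1 w * norm w)"
proof -
  define c where "c = (2 * pi) powr (- (real DIM('a) / 2)) / (4 * pi) powr (- (real DIM('a) / 2))"
  have *: "heat_kernel 1 w * norm w \<le> c * heat_kernel 2 w" for w :: 'a
  proof -
    have "norm w \<le> 1 + (norm w)\<^sup>2 / 4"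
      using zero_le_power2[of "norm w / 2 - 1"] by (simp add: power2_eq_square field_simps)
    also have "\<dots> \<le> exp ((norm w)\<^sup>2 / 4)" by (rule exp_ge_add_one_self)
    finally have "exp (- ((norm w)\<^sup>2 / 2)) * norm w \<le>
        exp (- ((norm w)\<^sup>2 / 2)) * exp ((norm w)\<^sup>2 / 4)"
      by (rule mult_left_mono) simp
    also have "\<dots> = exp (- ((norm w)\<^sup>2 / 4))" by (simp add: exp_add[symmetric])
    finally show ?thesis
      unfolding heat_kernel_def c_def by (simp add: mult.assoc mult_left_mono)
  qed
  have "integrable lborel (\<lambda>w :: 'a. c * heat_kernel 2 w)"
    by (intro integrable_mult_right heat_kernel_integral) simp
  then show ?thesis
    by (rule Bochner_Integration.integrable_bound)
      (use * in \<open>auto intro!: AE_I2 order_trans[OF _ abs_ge_self] simp: heat_kernel_nonneg\<close>)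
qed

definition gaussian_moment :: "'a::euclidean_space itself \<Rightarrow> real" where
  "gaussian_moment _ = (LINT w|lborel. heat_kernel 1 (w::'a) * (1 + norm w))"

lemma gaussian_moment_integrable:
  "integrable lborel (\<lambda>w :: 'a::euclidean_space. heat_kernel 1 w * (1 + norm w))"
  unfolding distrib_left mult_1_right
  by (intro Bochner_Integration.integrable_add heat_kernel_first_moment_integrable
      heat_kernel_integral) simp

lemma gaussian_moment_ge_1: "1 \<le> gaussian_moment TYPE('a::euclidean_space)"
proof -
  have "(LINT w|lborel. heat_kernel 1 (w::'a)) \<le> gaussian_moment TYPE('a)"
    unfolding gaussian_moment_def
    by (intro integral_mono gaussian_moment_integrable heat_kernel_integral)
      (auto simp: heat_kernel_nonneg distrib_left)
  then show ?thesis by (simp add: heat_kernel_integral)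
qed


section \<open>Gaussian averages\<close>

text \<open>
  Substituting \<open>y = x + \<surd>t w\<close> turns the heat semigroup into an average against one fixed
  probability density.  In this form \<open>t = 0\<close> is no exception, the time enters only as a
  displacement of the argument, and vector-valued functions such as gradients are covered.
\<close>

definition gaussian_average ::
    "real \<Rightarrow> ('a::euclidean_space \<Rightarrow> 'b::euclidean_space) \<Rightarrow> 'a \<Rightarrow> 'b" where
  "gaussian_average r f x = (LINT w|lborel. heat_kernel 1 w *\<^sub>R f (x + r *\<^sub>R w))"

lemma heat_kernel_scale:
  fixes w :: "'a::euclidean_space"
  assumes "0 < t"
  shows "sqrt t ^ DIM('a) * heat_kernel t (sqrt t *\<^sub>R w) = heat_kernel 1 w"
proof -
  have "sqrt t ^ DIM('a) = t powr (real DIM('a) / 2)"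
    using assms by (simp add: powr_half_sqrt[symmetric] powr_realpow[symmetric] powr_powr)
  then have "sqrt t ^ DIM('a) * (2 * pi * t) powr (- (real DIM('a) / 2)) =
      (2 * pi) powr (- (real DIM('a) / 2))"
    using assms by (simp add: powr_mult powr_minus)
  then show ?thesis
    using assms by (simp add: heat_kernel_def power_mult_distrib mult.assoc[symmetric])
qed

lemma heat_semigroup_eq_gaussian_average:
  fixes h :: "'a::euclidean_space \<Rightarrow> real"
  assumes "0 \<le> t" and cont: "continuous_on UNIV h"
  shows "heat_semigroup t h = gaussian_average (sqrt t) h"
proof (cases "t = 0")
  case True
  then show ?thesis
    by (auto simp: heat_semigroup_def gaussian_average_def heat_kernel_integral)
next
  case False
  with assms have t: "0 < t" by simp
  have [measurable]: "h \<in> borel_measurable borel"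
    using cont by (rule borel_measurable_continuous_onI)
  show ?thesis
  proof
    fix x
    have "heat_semigroup t h x = (LINT y|lborel. heat_kernel t (x - y) * h y)"
      using t by (simp add: heat_semigroup_def)
    also have "\<dots> = (LINT y|density (distr lborel borel (\<lambda>w. x + sqrt t *\<^sub>R w))
        (\<lambda>_. \<bar>sqrt t\<bar> ^ DIM('a)). heat_kernel t (x - y) * h y)"
      using t by (subst lborel_affine[of "sqrt t" x]) auto
    also have "\<dots> = (LINT w|lborel. sqrt t ^ DIM('a) *
        (heat_kernel t (x - (x + sqrt t *\<^sub>R w)) * h (x + sqrt t *\<^sub>R w)))"
      using t by (subst integral_density) (auto simp: integral_distr)
    also have "\<dots> = (LINT w|lborel. sqrt t ^ DIM('a) *
        heat_kernel t (sqrt t *\<^sub>R w) * h (x + sqrt t *\<^sub>R w))"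
      by (simp add: heat_kernel_def mult.assoc)
    also have "\<dots> = gaussian_average (sqrt t) h x"
      unfolding heat_kernel_scale[OF t] by (simp add: gaussian_average_def)
    finally show "heat_semigroup t h x = gaussian_average (sqrt t) h x" .
  qed
qed

lemma gaussian_average_integrable:
  fixes f :: "'a::euclidean_space \<Rightarrow> 'b::euclidean_space"
  assumes f: "holder_continuous \<theta> C f" and \<theta>: "0 < \<theta>" "\<theta> \<le> 1"
  shows "integrable lborel (\<lambda>w. heat_kernel 1 w *\<^sub>R f (x + r *\<^sub>R w))"
proof -
  have [measurable]: "f \<in> borel_measurable borel"
    using holder_continuous_imp_continuous[OF f \<theta>(1)] by (rule borel_measurable_continuous_onI)
  have C: "0 \<le> C" using holder_continuousD[OF f] by simp
  define B where "B = (norm (f 0) + C + C * norm x) + C * \<bar>r\<bar>"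
  have "norm (f (x + r *\<^sub>R w)) \<le> B * (1 + norm w)" for w
  proof -
    have "norm (f (x + r *\<^sub>R w)) \<le> norm (f 0) + C + C * norm (x + r *\<^sub>R w)"
      by (rule holder_continuous_linear_growth[OF f \<theta>])
    also have "C * norm (x + r *\<^sub>R w) \<le> C * (norm x + \<bar>r\<bar> * norm w)"
      using C norm_triangle_ineq[of x "r *\<^sub>R w"] by (intro mult_left_mono) auto
    also have "norm (f 0) + C + C * (norm x + \<bar>r\<bar> * norm w) \<le> B * (1 + norm w)"
      using C by (simp add: B_def algebra_simps)
    finally show ?thesis by simp
  qed
  then have *: "norm (heat_kernel 1 w *\<^sub>R f (x + r *\<^sub>R w)) \<le> B * (heat_kernel 1 w * (1 + norm w))"
    for w
    using mult_left_mono[OF _ heat_kernel_nonneg, of _ _ 1 w]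
    by (simp add: heat_kernel_nonneg mult.left_commute[of B])
  have "integrable lborel (\<lambda>w::'a. B * (heat_kernel 1 w * (1 + norm w)))"
    by (intro integrable_mult_right gaussian_moment_integrable)
  then show ?thesis
    by (rule Bochner_Integration.integrable_bound)
      (use * in \<open>auto intro!: AE_I2 order_trans[OF _ abs_ge_self]\<close>)
qed

text \<open>All estimates on averages come from integrating a pointwise bound against the density.\<close>

lemma norm_gaussian_integral_le:
  fixes u :: "'a::euclidean_space \<Rightarrow> 'b::euclidean_space"
  assumes "integrable lborel (\<lambda>w. heat_kernel 1 w *\<^sub>R u w)" "\<And>w. norm (u w) \<le> B"
  shows "norm (LINT w|lborel. heat_kernel 1 w *\<^sub>R u w) \<le> B"
proof -
  have "norm (LINT w|lborel. heat_kernel 1 w *\<^sub>R u w) \<le> (LINT w|lborel. heat_kernel 1 (w::'a) * B)"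
    using assms by (intro Bochner_Integration.integral_norm_bound_integral integrable_mult_left heat_kernel_integral)
      (auto simp: heat_kernel_nonneg mult_left_mono)
  then show ?thesis by (simp add: heat_kernel_integral)
qed

lemma gaussian_average_bounded:
  fixes f :: "'a::euclidean_space \<Rightarrow> 'b::euclidean_space"
  assumes "holder_continuous \<theta> C f" "0 < \<theta>" "\<theta> \<le> 1" "\<And>x. norm (f x) \<le> A"
  shows "norm (gaussian_average r f x) \<le> A"
  unfolding gaussian_average_def using assms
  by (intro norm_gaussian_integral_le gaussian_average_integrable) auto

lemma gaussian_average_diff:
  fixes f :: "'a::euclidean_space \<Rightarrow> 'b::euclidean_space"
  assumes f: "holder_continuous \<theta> C f" "0 < \<theta>" "\<theta> \<le> 1"
  shows "gaussian_average r f x - gaussian_average s f y =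
      (LINT w|lborel. heat_kernel 1 w *\<^sub>R (f (x + r *\<^sub>R w) - f (y + s *\<^sub>R w)))"
    and "integrable lborel (\<lambda>w. heat_kernel 1 w *\<^sub>R (f (x + r *\<^sub>R w) - f (y + s *\<^sub>R w)))"
  using gaussian_average_integrable[OF f]
  by (simp_all add: gaussian_average_def scaleR_diff_right)

lemma gaussian_average_holder_continuous:
  fixes f :: "'a::euclidean_space \<Rightarrow> 'b::euclidean_space"
  assumes f: "holder_continuous \<theta> C f" "0 < \<theta>" "\<theta> \<le> 1"
  shows "holder_continuous \<theta> C (gaussian_average r f)"
  unfolding holder_continuous_def
proof (intro conjI allI)
  show "0 \<le> C" using holder_continuousD[OF f(1)] by simp
  fix x y
  have "norm (f (x + r *\<^sub>R w) - f (y + r *\<^sub>R w)) \<le> C * dist x y powr \<theta>" for w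
    using holder_continuousD(2)[OF f(1), of "x + r *\<^sub>R w" "y + r *\<^sub>R w"] by simp
  then show "norm (gaussian_average r f x - gaussian_average r f y) \<le> C * dist x y powr \<theta>"
    unfolding gaussian_average_diff(1)[OF f]
    by (intro norm_gaussian_integral_le gaussian_average_diff[OF f])
qed

text \<open>
  Time regularity: between the scales \<open>r\<close> and \<open>s\<close> the argument of \<open>f\<close> moves by \<open>(r - s) w\<close>, and
  the Gaussian has finite moments.
\<close>

lemma gaussian_average_scale_diff:
  fixes f :: "'a::euclidean_space \<Rightarrow> 'b::euclidean_space"
  assumes f: "holder_continuous \<theta> C f" "0 < \<theta>" "\<theta> \<le> 1"
  shows "norm (gaussian_average r f x - gaussian_average s f x) \<le>
    C * gaussian_moment TYPE('a) * \<bar>r - s\<bar> powr \<theta>"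
proof -
  have C: "0 \<le> C" using holder_continuousD[OF f(1)] by simp
  let ?K = "C * \<bar>r - s\<bar> powr \<theta>"
  have "norm (f (x + r *\<^sub>R w) - f (x + s *\<^sub>R w)) \<le> ?K * (1 + norm w)" for w
  proof -
    have "norm (f (x + r *\<^sub>R w) - f (x + s *\<^sub>R w)) \<le> C * (\<bar>r - s\<bar> * norm w) powr \<theta>"
      using holder_continuousD(2)[OF f(1), of "x + r *\<^sub>R w" "x + s *\<^sub>R w"]
      by (simp add: dist_norm scaleR_diff_left[symmetric])
    also have "\<dots> = ?K * norm w powr \<theta>" by (simp add: powr_mult)
    also have "\<dots> \<le> ?K * (1 + norm w)"
      using C f by (intro mult_left_mono powr_le_1_plus) auto
    finally show ?thesis .
  qed
  then have "norm (gaussian_average r f x - gaussian_average s f x) \<le>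
      (LINT w|lborel. ?K * (heat_kernel 1 (w::'a) * (1 + norm w)))"
    unfolding gaussian_average_diff(1)[OF f]
    by (intro Bochner_Integration.integral_norm_bound_integral gaussian_average_diff[OF f] integrable_mult_right
        gaussian_moment_integrable)
      (auto simp: heat_kernel_nonneg mult.left_commute[of _ "heat_kernel 1 _"] intro!: mult_left_mono)
  then show ?thesis
    unfolding integral_mult_right_zero gaussian_moment_def by (simp only: mult_ac)
qed

text \<open>
  Interpolation, and the reason for assuming \<open>\<nu>\<close> more regularity: let \<open>\<eta> = \<bar>r - s\<bar>\<close>.  The increment
  over points at distance \<open>\<rho>\<close> is at most a constant times \<open>\<rho>\<close> to the power \<open>\<alpha> + \<nu>\<close> by regularity in
  space, and at most a constant times \<open>\<eta>\<close> to the same power by regularity in time.  Using the first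
  bound for \<open>\<rho> \<le> \<eta>\<close> and the second for \<open>\<rho> > \<eta>\<close> leaves \<open>\<rho>\<close> to the power \<open>\<alpha>\<close> times a factor
  that vanishes with \<open>\<eta>\<close>.
\<close>

lemma gaussian_average_scale_diff_holder:
  fixes f :: "'a::euclidean_space \<Rightarrow> 'b::euclidean_space"
  assumes f: "holder_continuous (\<alpha> + \<nu>) C f" and \<alpha>: "0 < \<alpha>" "0 < \<nu>" "\<alpha> + \<nu> \<le> 1"
  shows "holder_continuous \<alpha> (2 * C * gaussian_moment TYPE('a) * \<bar>r - s\<bar> powr \<nu>)
    (\<lambda>x. gaussian_average r f x - gaussian_average s f x)"
  unfolding holder_continuous_def
proof (intro conjI allI)
  let ?M = "gaussian_moment TYPE('a)"
  let ?F = "\<lambda>x. gaussian_average r f x - gaussian_average s f x"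
  have C: "0 \<le> C" using holder_continuousD[OF f] by simp
  have M: "1 \<le> ?M" by (rule gaussian_moment_ge_1)
  show "0 \<le> 2 * C * ?M * \<bar>r - s\<bar> powr \<nu>" using C M by simp
  have f': "0 < \<alpha> + \<nu>" using \<alpha> by simp
  fix x y
  let ?\<eta> = "\<bar>r - s\<bar>"
  have "norm (?F x - ?F y) \<le> 2 * C * ?M * (dist x y powr \<alpha> * ?\<eta> powr \<nu>)"
  proof (cases "dist x y \<le> ?\<eta>")
    case True
    have "norm (?F x - ?F y) \<le> norm (gaussian_average r f x - gaussian_average r f y) +
        norm (gaussian_average s f x - gaussian_average s f y)"
      using norm_triangle_ineq4[of "gaussian_average r f x - gaussian_average r f y"
        "gaussian_average s f x - gaussian_average s f y"] by (simp add: algebra_simps)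
    also have "\<dots> \<le> C * dist x y powr (\<alpha> + \<nu>) + C * dist x y powr (\<alpha> + \<nu>)"
      by (intro add_mono holder_continuousD(2) gaussian_average_holder_continuous[OF f f' \<alpha>(3)])
    also have "\<dots> = 2 * C * (dist x y powr \<alpha> * dist x y powr \<nu>)"
      by (simp add: powr_add)
    also have "\<dots> \<le> 2 * C * (dist x y powr \<alpha> * ?\<eta> powr \<nu>)"
      using C True \<alpha> by (intro mult_left_mono powr_mono2) auto
    also have "\<dots> \<le> 2 * C * ?M * (dist x y powr \<alpha> * ?\<eta> powr \<nu>)"
      using C M by (intro mult_right_mono) (auto simp: mult_le_cancel_left1)
    finally show ?thesis .
  next
    case False
    have "norm (?F x - ?F y) \<le> norm (?F x) + norm (?F y)" by (rule norm_triangle_ineq4)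
    also have "\<dots> \<le> C * ?M * ?\<eta> powr (\<alpha> + \<nu>) + C * ?M * ?\<eta> powr (\<alpha> + \<nu>)"
      by (intro add_mono gaussian_average_scale_diff[OF f f' \<alpha>(3)])
    also have "\<dots> = 2 * C * ?M * (?\<eta> powr \<alpha> * ?\<eta> powr \<nu>)" by (simp add: powr_add)
    also have "\<dots> \<le> 2 * C * ?M * (dist x y powr \<alpha> * ?\<eta> powr \<nu>)"
      using C M False \<alpha> by (intro mult_left_mono mult_right_mono powr_mono2) auto
    finally show ?thesis .
  qed
  then show "norm (?F x - ?F y) \<le> 2 * C * ?M * \<bar>r - s\<bar> powr \<nu> * dist x y powr \<alpha>"
    by (simp add: mult_ac)
qed

lemma gaussian_average_has_derivative:
  fixes h :: "'a::euclidean_space \<Rightarrow> real"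
  assumes h: "\<And>x. (h has_derivative (\<lambda>v. v \<bullet> G x)) (at x)"
    and A: "\<And>x. norm (G x) \<le> A" and G: "holder_continuous \<theta> C G" "0 < \<theta>" "\<theta> \<le> 1"
  shows "(gaussian_average r h has_derivative (\<lambda>v. v \<bullet> gaussian_average r G x)) (at x)"
proof -
  have lip: "holder_continuous 1 A h" by (rule bounded_gradient_imp_lipschitz[OF h A])
  note int_h = gaussian_average_diff[OF lip zero_less_one order_refl]
  have rem: "norm (gaussian_average r h (x + v) - gaussian_average r h x
      - v \<bullet> gaussian_average r G x) \<le> C * norm v powr \<theta> * norm v" for v
  proof -
    let ?u = "\<lambda>w. h (x + v + r *\<^sub>R w) - h (x + r *\<^sub>R w)"
    let ?k = "\<lambda>w. v \<bullet> G (x + r *\<^sub>R w)"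
    have k: "integrable lborel (\<lambda>w. heat_kernel 1 w *\<^sub>R ?k w)"
      "v \<bullet> gaussian_average r G x = (LINT w|lborel. heat_kernel 1 w *\<^sub>R ?k w)"
      using integrable_inner_right[of v, OF gaussian_average_integrable[OF G, of x r]]
        integral_inner_right[of v, OF gaussian_average_integrable[OF G, of x r]]
      by (simp_all add: gaussian_average_def)
    have "gaussian_average r h (x + v) - gaussian_average r h x - v \<bullet> gaussian_average r G x =
        (LINT w|lborel. heat_kernel 1 w *\<^sub>R (?u w - ?k w))"
      unfolding int_h(1) k(2) scaleR_diff_right[of _ "?u _"]
      by (rule Bochner_Integration.integral_diff[symmetric, OF int_h(2) k(1)])
    also have "norm \<dots> \<le> C * norm v powr \<theta> * norm v"
    proof (rule norm_gaussian_integral_le)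
      show "integrable lborel (\<lambda>w. heat_kernel 1 w *\<^sub>R (?u w - ?k w))"
        unfolding scaleR_diff_right[of _ "?u _"]
        by (rule Bochner_Integration.integrable_diff[OF int_h(2) k(1)])
      show "norm (?u w - ?k w) \<le> C * norm v powr \<theta> * norm v" for w
        using taylor_remainder_holder_gradient[OF h G(1,2), of "x + r *\<^sub>R w" v]
        by (simp add: add_ac)
    qed
    finally show ?thesis .
  qed
  have "((\<lambda>v. norm (gaussian_average r h (x + v) - gaussian_average r h x
      - v \<bullet> gaussian_average r G x) / norm v) \<longlongrightarrow> 0) (at 0)"
  proof (rule Lim_null_comparison)
    have "((\<lambda>v::'a. norm v powr \<theta>) \<longlongrightarrow> 0) (at 0)"
      using G by (intro tendsto_zero_powrI[where b = \<theta>]) (auto intro!: tendsto_eq_intros)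
    then show "((\<lambda>v::'a. C * norm v powr \<theta>) \<longlongrightarrow> 0) (at 0)"
      by (rule tendsto_mult_right_zero)
    show "\<forall>\<^sub>F v in at 0. norm (norm (gaussian_average r h (x + v) - gaussian_average r h x
      - v \<bullet> gaussian_average r G x) / norm v) \<le> C * norm v powr \<theta>"
      using rem by (auto simp: eventually_at divide_le_eq intro!: exI[of _ 1])
  qed
  then show ?thesis
    by (simp add: has_derivative_at bounded_linear_inner_left)
qed


section \<open>Continuity of the heat semigroup\<close>

lemma D_holder_space_imp_continuous:
  fixes h :: "'a::euclidean_space \<Rightarrow> real"
  assumes "h \<in> D_holder_space \<theta>"
  shows "continuous_on UNIV h"
  using assms unfolding D_holder_space_def
  by (auto intro!: continuous_at_imp_continuous_on differentiable_imp_continuous_within)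

lemma heat_semigroup_D_holder_space:
  fixes h :: "'a::euclidean_space \<Rightarrow> real"
  assumes "0 < \<theta>" "\<theta> < 1" "0 \<le> t" "h \<in> D_holder_space \<theta>"
  shows "heat_semigroup t h \<in> D_holder_space \<theta>"
proof -
  obtain G A C where h: "\<And>x. (h has_derivative (\<lambda>v. v \<bullet> G x)) (at x)"
    and A: "\<And>x. norm (G x) \<le> A" and G: "holder_continuous \<theta> C G"
    using assms(4) unfolding D_holder_space_iff[OF assms(1,2)] by blast
  have \<theta>: "0 < \<theta>" "\<theta> \<le> 1" using assms by auto
  show ?thesis
    unfolding D_holder_space_iff[OF assms(1,2)]
      heat_semigroup_eq_gaussian_average[OF assms(3) D_holder_space_imp_continuous[OF assms(4)]]
    using gaussian_average_has_derivative[OF h A G \<theta>] gaussian_average_bounded[OF G \<theta> A]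
      gaussian_average_holder_continuous[OF G \<theta>] by blast
qed

lemma bounded_heat_semigroup:
  fixes h :: "'a::euclidean_space \<Rightarrow> real"
  assumes "0 < \<theta>" "\<theta> < 1" "0 \<le> t" "h \<in> D_holder_space \<theta>" "bounded (range h)"
  shows "bounded (range (heat_semigroup t h))"
proof -
  obtain G A where h: "\<And>x. (h has_derivative (\<lambda>v. v \<bullet> G x)) (at x)"
    and A: "\<And>x. norm (G x) \<le> A"
    using assms(4) unfolding D_holder_space_iff[OF assms(1,2)] by blast
  obtain B where B: "\<And>x. norm (h x) \<le> B" using assms(5) by (auto simp: bounded_iff)
  show ?thesis
    unfolding heat_semigroup_eq_gaussian_average[OF assms(3) D_holder_space_imp_continuous[OF assms(4)]]
    using gaussian_average_bounded[OF bounded_gradient_imp_lipschitz[OF h A] zero_less_one order_refl B]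
    by (auto simp: bounded_iff)
qed

text \<open>
  One quantitative estimate serves both scales of spaces.  The sup norm of the increment of
  \<open>P\<^sub>t h\<close> is of order \<open>\<eta> = \<bar>\<surd>s - \<surd>t\<bar>\<close> since \<open>h\<close> is Lipschitz; that of its gradient is of order
  \<open>\<eta>\<close> to the power \<open>\<alpha> + \<nu>\<close>, and the Hoelder seminorm of the gradient of order \<open>\<eta>\<close> to the power \<open>\<nu>\<close>.
\<close>

lemma heat_semigroup_increment:
  fixes h :: "'a::euclidean_space \<Rightarrow> real"
  assumes \<alpha>: "0 < \<alpha>" "0 < \<nu>" "\<alpha> + \<nu> < 1" and hD: "h \<in> D_holder_space (\<alpha> + \<nu>)"
  obtains K where "0 \<le> K" and
    "\<And>s t. 0 \<le> s \<Longrightarrow> 0 \<le> t \<Longrightarrow> \<exists>G.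
       (\<forall>x. ((\<lambda>x. heat_semigroup s h x - heat_semigroup t h x) has_derivative (\<lambda>v. v \<bullet> G x)) (at x)) \<and>
       (\<forall>x. \<bar>heat_semigroup s h x - heat_semigroup t h x\<bar> \<le> K * \<bar>sqrt s - sqrt t\<bar>) \<and>
       (\<forall>x. norm (G x) \<le> K * \<bar>sqrt s - sqrt t\<bar> powr (\<alpha> + \<nu>)) \<and>
       holder_continuous \<alpha> (K * \<bar>sqrt s - sqrt t\<bar> powr \<nu>) G"
proof -
  have \<theta>: "0 < \<alpha> + \<nu>" "\<alpha> + \<nu> \<le> 1" using \<alpha> by auto
  obtain G A C where h: "\<And>x. (h has_derivative (\<lambda>v. v \<bullet> G x)) (at x)"
    and A: "\<And>x. norm (G x) \<le> A" and G: "holder_continuous (\<alpha> + \<nu>) C G"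
    using hD unfolding D_holder_space_iff[OF \<theta>(1) \<alpha>(3)] by blast
  have lip: "holder_continuous 1 A h" by (rule bounded_gradient_imp_lipschitz[OF h A])
  let ?M = "gaussian_moment TYPE('a)"
  have M: "1 \<le> ?M" by (rule gaussian_moment_ge_1)
  have AC: "0 \<le> A" "0 \<le> C" using holder_continuousD(1)[OF lip] holder_continuousD(1)[OF G] by auto
  define K where "K = (A + 2 * C) * ?M"
  have K: "0 \<le> K" "A * ?M \<le> K" "2 * C * ?M \<le> K" "C * ?M \<le> K"
    using AC M by (auto simp: K_def intro!: mult_right_mono)
  show ?thesis
  proof (rule that[OF K(1)])
    fix s t :: real
    assume st: "0 \<le> s" "0 \<le> t"
    let ?\<eta> = "\<bar>sqrt s - sqrt t\<bar>"
    define F where "F = (\<lambda>x. gaussian_average (sqrt s) G x - gaussian_average (sqrt t) G x)"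
    note eq = heat_semigroup_eq_gaussian_average[OF _ D_holder_space_imp_continuous[OF hD]]
    have "\<bar>heat_semigroup s h x - heat_semigroup t h x\<bar> \<le> K * ?\<eta>" for x
    proof -
      have "\<bar>heat_semigroup s h x - heat_semigroup t h x\<bar> \<le> A * ?M * ?\<eta>"
        unfolding eq[OF st(1)] eq[OF st(2)]
        using gaussian_average_scale_diff[OF lip, of "sqrt s" x "sqrt t"] by simp
      also have "\<dots> \<le> K * ?\<eta>" using K by (intro mult_right_mono) auto
      finally show ?thesis .
    qed
    moreover have "norm (F x) \<le> K * ?\<eta> powr (\<alpha> + \<nu>)" for x
    proof -
      have "norm (F x) \<le> C * ?M * ?\<eta> powr (\<alpha> + \<nu>)"
        unfolding F_def by (rule gaussian_average_scale_diff[OF G \<theta>])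
      also have "\<dots> \<le> K * ?\<eta> powr (\<alpha> + \<nu>)" using K by (intro mult_right_mono) auto
      finally show ?thesis .
    qed
    moreover have "holder_continuous \<alpha> (K * ?\<eta> powr \<nu>) F"
    proof -
      have "2 * C * ?M * ?\<eta> powr \<nu> * dist x y powr \<alpha> \<le> K * ?\<eta> powr \<nu> * dist x y powr \<alpha>" for x y :: 'a
        using K by (intro mult_right_mono) auto
      with gaussian_average_scale_diff_holder[OF G \<alpha>(1,2) \<theta>(2), of "sqrt s" "sqrt t"] K(1)
      show ?thesis
        unfolding F_def holder_continuous_def by (meson mult_nonneg_nonneg order_trans powr_ge_zero)
    qed
    moreover have "((\<lambda>x. heat_semigroup s h x - heat_semigroup t h x) has_derivative
        (\<lambda>v. v \<bullet> F x)) (at x)" for x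
      unfolding eq[OF st(1)] eq[OF st(2)] F_def inner_diff_right
      by (intro has_derivative_diff gaussian_average_has_derivative[OF h A G \<theta>])
    ultimately show "\<exists>G.
       (\<forall>x. ((\<lambda>x. heat_semigroup s h x - heat_semigroup t h x) has_derivative (\<lambda>v. v \<bullet> G x)) (at x)) \<and>
       (\<forall>x. \<bar>heat_semigroup s h x - heat_semigroup t h x\<bar> \<le> K * ?\<eta>) \<and>
       (\<forall>x. norm (G x) \<le> K * ?\<eta> powr (\<alpha> + \<nu>)) \<and>
       holder_continuous \<alpha> (K * ?\<eta> powr \<nu>) G" by blast
  qed
qed

lemma C_T_heat_semigroupI:
  fixes h :: "'a::euclidean_space \<Rightarrow> real"
  assumes X: "\<And>t. 0 \<le> t \<Longrightarrow> heat_semigroup t h \<in> X" and exps: "0 < \<theta>" "0 < \<nu>"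
    and N: "\<And>s t. 0 \<le> s \<Longrightarrow> 0 \<le> t \<Longrightarrow>
      \<bar>N (\<lambda>x. heat_semigroup s h x - heat_semigroup t h x)\<bar> \<le>
        K * (\<bar>sqrt s - sqrt t\<bar> + \<bar>sqrt s - sqrt t\<bar> powr \<theta> + \<bar>sqrt s - sqrt t\<bar> powr \<nu>)"
  shows "(\<lambda>t. heat_semigroup t h) \<in> C_T T X N"
  unfolding C_T_def mem_Collect_eq
proof (intro conjI ballI)
  fix t assume t: "t \<in> {0..T}"
  then show "heat_semigroup t h \<in> X" using X by simp
  let ?F = "at t within {0..T}"
  have \<eta>: "((\<lambda>s. \<bar>sqrt s - sqrt t\<bar>) \<longlongrightarrow> 0) ?F"
    by (auto intro!: tendsto_eq_intros)
  have powr: "((\<lambda>s. \<bar>sqrt s - sqrt t\<bar> powr e) \<longlongrightarrow> 0) ?F" if "0 < e" for e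
    by (rule tendsto_zero_powrI[OF \<eta> tendsto_const _ that]) simp
  show "((\<lambda>s. N (\<lambda>x. heat_semigroup s h x - heat_semigroup t h x)) \<longlongrightarrow> 0) ?F"
  proof (rule Lim_null_comparison)
    show "\<forall>\<^sub>F s in ?F. norm (N (\<lambda>x. heat_semigroup s h x - heat_semigroup t h x)) \<le>
        K * (\<bar>sqrt s - sqrt t\<bar> + \<bar>sqrt s - sqrt t\<bar> powr \<theta> + \<bar>sqrt s - sqrt t\<bar> powr \<nu>)"
      using t N unfolding eventually_at_filter by (auto intro!: always_eventually)
    show "((\<lambda>s. K * (\<bar>sqrt s - sqrt t\<bar> + \<bar>sqrt s - sqrt t\<bar> powr \<theta> +
        \<bar>sqrt s - sqrt t\<bar> powr \<nu>)) \<longlongrightarrow> 0) ?F"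
      using tendsto_mult[OF tendsto_const[of K]
        tendsto_add[OF tendsto_add[OF \<eta> powr[OF exps(1)]] powr[OF exps(2)]]] by simp
  qed
qed

lemma heat_semigroup_C_T_D_holder:
  fixes h :: "'a::euclidean_space \<Rightarrow> real"
  assumes \<alpha>: "0 < \<alpha>" "0 < \<nu>" "\<alpha> + \<nu> < 1" and h: "h \<in> D_holder_space (\<alpha> + \<nu>)"
  shows "(\<lambda>t. heat_semigroup t h) \<in> C_T T (D_holder_space \<alpha>) (D_holder_norm \<alpha>)"
proof -
  have \<alpha>1: "0 < \<alpha>" "\<alpha> < 1" "0 < \<alpha> + \<nu>" using \<alpha> by auto
  have X: "h \<in> D_holder_space \<alpha>"
    by (rule D_holder_space_mono[OF \<alpha>(1) _ \<alpha>(3) h]) (use \<alpha> in simp)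
  obtain K where K: "0 \<le> K" and inc: "\<And>s t. 0 \<le> s \<Longrightarrow> 0 \<le> t \<Longrightarrow> \<exists>G.
       (\<forall>x. ((\<lambda>x. heat_semigroup s h x - heat_semigroup t h x) has_derivative (\<lambda>v. v \<bullet> G x)) (at x)) \<and>
       (\<forall>x. \<bar>heat_semigroup s h x - heat_semigroup t h x\<bar> \<le> K * \<bar>sqrt s - sqrt t\<bar>) \<and>
       (\<forall>x. norm (G x) \<le> K * \<bar>sqrt s - sqrt t\<bar> powr (\<alpha> + \<nu>)) \<and>
       holder_continuous \<alpha> (K * \<bar>sqrt s - sqrt t\<bar> powr \<nu>) G"
    using heat_semigroup_increment[OF \<alpha> h] by blast
  show ?thesis
  proof (rule C_T_heat_semigroupI[OF _ \<alpha>1(3) \<alpha>(2)])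
    show "heat_semigroup t h \<in> D_holder_space \<alpha>" if "0 \<le> t" for t
      using heat_semigroup_D_holder_space[OF \<alpha>1(1,2) that X] .
    fix s t :: real
    assume st: "0 \<le> s" "0 \<le> t"
    let ?\<eta> = "\<bar>sqrt s - sqrt t\<bar>"
    let ?D = "\<lambda>x. heat_semigroup s h x - heat_semigroup t h x"
    obtain G where G: "\<And>x. (?D has_derivative (\<lambda>v. v \<bullet> G x)) (at x)"
      "\<And>x. \<bar>?D x\<bar> \<le> K * ?\<eta>" "\<And>x. norm (G x) \<le> K * ?\<eta> powr (\<alpha> + \<nu>)"
      "holder_continuous \<alpha> (K * ?\<eta> powr \<nu>) G"
      using inc[OF st] by blast
    have "D_holder_norm \<alpha> ?D = \<bar>?D 0\<bar> + holder_class_norm 0 \<alpha> G"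
      unfolding D_holder_norm_def holder_norm_def floor_frac_unit_interval[OF \<alpha>1(1,2)]
        gradient_partial_deriv_eq(2)[OF G(1)] ..
    with G(2)[of 0] holder_class_norm_0_bounds[OF G(3,4)]
    show "\<bar>D_holder_norm \<alpha> ?D\<bar> \<le> K * (?\<eta> + ?\<eta> powr (\<alpha> + \<nu>) + ?\<eta> powr \<nu>)"
      by (simp add: distrib_left)
  qed
qed

lemma heat_semigroup_C_T_holder:
  fixes h :: "'a::euclidean_space \<Rightarrow> real"
  assumes \<alpha>: "0 < \<alpha>" "0 < \<nu>" "\<alpha> + \<nu> < 1" and h: "h \<in> D_holder_space (\<alpha> + \<nu>)"
    and bdd: "bounded (range h)"
  shows "(\<lambda>t. heat_semigroup t h) \<in> C_T T (holder_space (1 + \<alpha>)) (holder_norm (1 + \<alpha>))"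
proof -
  have \<alpha>1: "0 < \<alpha>" "\<alpha> < 1" "0 < \<alpha> + \<nu>" using \<alpha> by auto
  have X: "h \<in> D_holder_space \<alpha>"
    by (rule D_holder_space_mono[OF \<alpha>(1) _ \<alpha>(3) h]) (use \<alpha> in simp)
  obtain K where K: "0 \<le> K" and inc: "\<And>s t. 0 \<le> s \<Longrightarrow> 0 \<le> t \<Longrightarrow> \<exists>G.
       (\<forall>x. ((\<lambda>x. heat_semigroup s h x - heat_semigroup t h x) has_derivative (\<lambda>v. v \<bullet> G x)) (at x)) \<and>
       (\<forall>x. \<bar>heat_semigroup s h x - heat_semigroup t h x\<bar> \<le> K * \<bar>sqrt s - sqrt t\<bar>) \<and>
       (\<forall>x. norm (G x) \<le> K * \<bar>sqrt s - sqrt t\<bar> powr (\<alpha> + \<nu>)) \<and>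
       holder_continuous \<alpha> (K * \<bar>sqrt s - sqrt t\<bar> powr \<nu>) G"
    using heat_semigroup_increment[OF \<alpha> h] by blast
  show ?thesis
  proof (rule C_T_heat_semigroupI[OF _ \<alpha>1(3) \<alpha>(2), where K = "real DIM('a) * K"])
    show "heat_semigroup t h \<in> holder_space (1 + \<alpha>)" if "0 \<le> t" for t
      using heat_semigroup_D_holder_space[OF \<alpha>1(1,2) that X]
        bounded_heat_semigroup[OF \<alpha>1(1,2) that X bdd]
      unfolding holder_space_Suc_eq[OF \<alpha>1(1,2)] by blast
    fix s t :: real
    assume st: "0 \<le> s" "0 \<le> t"
    let ?\<eta> = "\<bar>sqrt s - sqrt t\<bar>"
    let ?D = "\<lambda>x. heat_semigroup s h x - heat_semigroup t h x"
    obtain G where G: "\<And>x. (?D has_derivative (\<lambda>v. v \<bullet> G x)) (at x)"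
      "\<And>x. \<bar>?D x\<bar> \<le> K * ?\<eta>" "\<And>x. norm (G x) \<le> K * ?\<eta> powr (\<alpha> + \<nu>)"
      "holder_continuous \<alpha> (K * ?\<eta> powr \<nu>) G"
      using inc[OF st] by blast
    have eq: "holder_norm (1 + \<alpha>) ?D =
        sup_norm ?D + (\<Sum>i\<in>Basis. holder_class_norm 0 \<alpha> (\<lambda>x. i \<bullet> G x))"
      unfolding holder_norm_def floor_frac_unit_interval[OF \<alpha>1(1,2)] holder_class_norm.simps(2)
        gradient_partial_deriv_eq(1)[OF G(1)] ..
    have part: "0 \<le> holder_class_norm 0 \<alpha> (\<lambda>x. i \<bullet> G x) \<and>
        holder_class_norm 0 \<alpha> (\<lambda>x. i \<bullet> G x) \<le> K * ?\<eta> powr (\<alpha> + \<nu>) + K * ?\<eta> powr \<nu>"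
      if "i \<in> Basis" for i
      using holder_class_norm_0_bounds[of "\<lambda>x. i \<bullet> G x" "K * ?\<eta> powr (\<alpha> + \<nu>)" \<alpha> "K * ?\<eta> powr \<nu>"]
        abs_inner_le[OF G(3) that] holder_continuous_inner[OF G(4), of i] that by auto
    have "0 \<le> sup_norm ?D" "sup_norm ?D \<le> K * ?\<eta>"
      using sup_norm_bounds[of ?D] G(2) by auto
    moreover have "K * ?\<eta> \<le> real DIM('a) * (K * ?\<eta>)"
      using K DIM_positive[where 'a = 'a] mult_right_mono[of 1 "real DIM('a)" "K * ?\<eta>"] by simp
    moreover have "0 \<le> (\<Sum>i\<in>Basis. holder_class_norm 0 \<alpha> (\<lambda>x. i \<bullet> G x))"
      using part by (auto intro!: sum_nonneg)
    moreover have "(\<Sum>i\<in>Basis. holder_class_norm 0 \<alpha> (\<lambda>x. i \<bullet> G x)) \<le>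
        real DIM('a) * (K * ?\<eta> powr (\<alpha> + \<nu>) + K * ?\<eta> powr \<nu>)"
      using part by (intro sum_bounded_above) auto
    ultimately show "\<bar>holder_norm (1 + \<alpha>) ?D\<bar> \<le>
        real DIM('a) * K * (?\<eta> + ?\<eta> powr (\<alpha> + \<nu>) + ?\<eta> powr \<nu>)"
      unfolding eq by (simp add: distrib_left mult.assoc)
  qed
qed

theorem lemma3p3:
  fixes \<alpha> T :: real
  assumes "0 < \<alpha>" and "\<alpha> < 1" and "0 < T"
  shows
    "(\<forall>t\<ge>0. \<forall>h :: 'a::euclidean_space \<Rightarrow> real.
        h \<in> holder_space (\<alpha> + 1) \<longrightarrow> heat_semigroup t h \<in> holder_space (\<alpha> + 1)) \<and>
     (\<forall>\<nu>>0. \<alpha> + \<nu> \<in> {0<..<1} \<longrightarrow> (\<forall>h :: 'a \<Rightarrow> real.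
        h \<in> holder_space (1 + \<alpha> + \<nu>) \<longrightarrow>
          (\<lambda>t. heat_semigroup t h) \<in> C_T T (holder_space (1 + \<alpha>)) (holder_norm (1 + \<alpha>)))) \<and>
     (\<forall>t\<ge>0. \<forall>h :: 'a \<Rightarrow> real.
        h \<in> D_holder_space \<alpha> \<longrightarrow> heat_semigroup t h \<in> D_holder_space \<alpha>) \<and>
     (\<forall>\<nu>>0. \<alpha> + \<nu> \<in> {0<..<1} \<longrightarrow> (\<forall>h :: 'a \<Rightarrow> real.
        h \<in> D_holder_space (\<alpha> + \<nu>) \<longrightarrow>
          (\<lambda>t. heat_semigroup t h) \<in> C_T T (D_holder_space \<alpha>) (D_holder_norm \<alpha>)))"
proof (intro conjI allI impI)
  note \<alpha> = assms(1,2)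
  note Suc_eq = holder_space_Suc_eq[where 'a = 'a]
  show "heat_semigroup t h \<in> holder_space (\<alpha> + 1)"
    if "0 \<le> t" "h \<in> holder_space (\<alpha> + 1)" for t and h :: "'a \<Rightarrow> real"
    using that heat_semigroup_D_holder_space[OF \<alpha>, of t h] bounded_heat_semigroup[OF \<alpha>, of t h]
    unfolding add.commute[of \<alpha> 1] Suc_eq[OF \<alpha>] by blast
  show "heat_semigroup t h \<in> D_holder_space \<alpha>"
    if "0 \<le> t" "h \<in> D_holder_space \<alpha>" for t and h :: "'a \<Rightarrow> real"
    using heat_semigroup_D_holder_space[OF \<alpha> that] .
  fix \<nu> :: real and h :: "'a \<Rightarrow> real"
  assume \<nu>: "0 < \<nu>" "\<alpha> + \<nu> \<in> {0<..<1}"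
  then have sum: "0 < \<alpha> + \<nu>" "\<alpha> + \<nu> < 1" by auto
  show "(\<lambda>t. heat_semigroup t h) \<in> C_T T (D_holder_space \<alpha>) (D_holder_norm \<alpha>)"
    if "h \<in> D_holder_space (\<alpha> + \<nu>)"
    using heat_semigroup_C_T_D_holder[OF \<alpha>(1) \<nu>(1) sum(2) that] .
  show "(\<lambda>t. heat_semigroup t h) \<in> C_T T (holder_space (1 + \<alpha>)) (holder_norm (1 + \<alpha>))"
    if "h \<in> holder_space (1 + \<alpha> + \<nu>)"
    using that heat_semigroup_C_T_holder[OF \<alpha>(1) \<nu>(1) sum(2), of h]
    unfolding add.assoc Suc_eq[OF sum] by auto
qed

end
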